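(* For any simple mixed graph $G$, $\boldsymbol{\nu}_1(G)\leq \max A$, where $A=\{x\mid x=d(u)+d(v)+d^+(u)+d^+(v)\text{ or }x=d(u)+d(v)+d^-(u)+d^-(v),\ \text{for } u,v\in V_G \text{ joined by an edge}\}\cup\{x\mid x=d(u)+d(v)+d^+(u)+d^-(v),\ \text{for } u,v\in V_G \text{ with an arc from } u \text{ to } v\}$, and $\boldsymbol{\nu}_1(G)$ is the largest eigenvalue of the integrated Laplacian matrix of $G$.
   Context: A mixed graph $G$ has a finite vertex set $V_G$, a multiset $E_G$ of edges (unordered pairs) and a multiset $\vec{E}_G$ of arcs (ordered pairs); it is simple if it has no loops, directed loops, multiple edges or multiple arcs. $d(v)$ is the number of edges at $v$; $d^+(v)$ (resp. $d^-(v)$) is the number of arcs starting (resp. ending) at $v$. For $V_G=\{v_1,\dots,v_n\}$, the integrated adjacency matrix $\mathcal{I}(G)$ is the $2n\times 2n$ matrix indexed by $v'_1,\dots,v'_n,v''_1,\dots,v''_n$ whose $(v'_i,v'_j)$ and $(v''_i,v''_j)$ entries are the number of edges joining $v_i,v_j$ and whose $(v'_i,v''_j)$ and $(v''_j,v'_i)$ entries are the number of arcs from $v_i$ to $v_j$. The integrated degree matrix $\mathcal{I}^D(G)$ is diagonal with $(v'_i,v'_i)$ entry $d(v_i)+d^+(v_i)$ and $(v''_i,v''_i)$ entry $d(v_i)+d^-(v_i)$; the integrated Laplacian matrix is $\mathcal{I}^L(G)=\mathcal{I}^D(G)-\mathcal{I}(G)$. *)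

theory Defs
  imports Jordan_Normal_Form.Spectral_Radius "HOL-Library.Multiset" "HOL-Library.Uprod"
begin

record 'a mixed_graph =
  verts :: "'a set"
  edges :: "'a uprod multiset"
  arcs :: "('a \<times> 'a) multiset"

definition mixed_graph :: "'a mixed_graph \<Rightarrow> bool" where
  "mixed_graph G \<longleftrightarrow>
     finite (verts G) \<and>
     (\<forall>e \<in># edges G. set_uprod e \<subseteq> verts G) \<and>
     (\<forall>(u, v) \<in># arcs G. u \<in> verts G \<and> v \<in> verts G)"

text \<open>Opposite arcs \<open>(u, v)\<close> and \<open>(v, u)\<close> are different ordered pairs, so a simple mixed graph
  may contain both, and it may contain an edge and an arc on the same two vertices.\<close>

definition simple_mixed_graph :: "'a mixed_graph \<Rightarrow> bool" where
  "simple_mixed_graph G \<longleftrightarrow>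
     mixed_graph G \<and>
     (\<forall>v. Upair v v \<notin># edges G) \<and>
     (\<forall>v. (v, v) \<notin># arcs G) \<and>
     (\<forall>e. count (edges G) e \<le> 1) \<and>
     (\<forall>a. count (arcs G) a \<le> 1)"

definition deg :: "'a mixed_graph \<Rightarrow> 'a \<Rightarrow> nat" where
  "deg G v = size {# e \<in># edges G. v \<in> set_uprod e #}"

definition out_deg :: "'a mixed_graph \<Rightarrow> 'a \<Rightarrow> nat" where
  "out_deg G v = size {# a \<in># arcs G. fst a = v #}"

definition in_deg :: "'a mixed_graph \<Rightarrow> 'a \<Rightarrow> nat" where
  "in_deg G v = size {# a \<in># arcs G. snd a = v #}"

text \<open>The matrices depend on an enumeration \<open>vs\<close> of the vertices, a list without repetitions of
  length \<open>n\<close>. For \<open>i < n\<close>, index \<open>i\<close> stands for the first copy \<open>v'\<close> and index \<open>n + i\<close> for the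
  second copy \<open>v''\<close> of the vertex \<open>v = vs ! i\<close>.\<close>

definition edge_mat :: "'a mixed_graph \<Rightarrow> 'a list \<Rightarrow> real mat" where
  "edge_mat G vs = mat (length vs) (length vs)
     (\<lambda>(i, j). real (count (edges G) (Upair (vs ! i) (vs ! j))))"

definition arc_mat :: "'a mixed_graph \<Rightarrow> 'a list \<Rightarrow> real mat" where
  "arc_mat G vs = mat (length vs) (length vs)
     (\<lambda>(i, j). real (count (arcs G) (vs ! i, vs ! j)))"

definition integrated_adjacency :: "'a mixed_graph \<Rightarrow> 'a list \<Rightarrow> real mat" where
  "integrated_adjacency G vs =
     four_block_mat (edge_mat G vs) (arc_mat G vs) (transpose_mat (arc_mat G vs)) (edge_mat G vs)"

definition integrated_degree :: "'a mixed_graph \<Rightarrow> 'a list \<Rightarrow> real mat" where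
  "integrated_degree G vs = (let n = length vs in
     mat_diag (2 * n) (\<lambda>i.
       if i < n then real (deg G (vs ! i) + out_deg G (vs ! i))
       else real (deg G (vs ! (i - n)) + in_deg G (vs ! (i - n)))))"

definition integrated_laplacian :: "'a mixed_graph \<Rightarrow> 'a list \<Rightarrow> real mat" where
  "integrated_laplacian G vs = integrated_degree G vs - integrated_adjacency G vs"

text \<open>The integrated Laplacian matrix is real symmetric, so all its eigenvalues are real and the
  spectrum over the reals is the full one. It is finite, and nonempty when \<open>vs \<noteq> []\<close>.\<close>

definition nu1 :: "'a mixed_graph \<Rightarrow> 'a list \<Rightarrow> real" where
  "nu1 G vs = Max (spectrum (integrated_laplacian G vs))"

definition bound_set :: "'a mixed_graph \<Rightarrow> nat set" where
  "bound_set G =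
     {x. \<exists>u \<in> verts G. \<exists>v \<in> verts G. Upair u v \<in># edges G \<and>
           (x = deg G u + deg G v + out_deg G u + out_deg G v \<or>
            x = deg G u + deg G v + in_deg G u + in_deg G v)} \<union>
     {x. \<exists>u \<in> verts G. \<exists>v \<in> verts G. (u, v) \<in># arcs G \<and>
           x = deg G u + deg G v + out_deg G u + in_deg G v}"

text \<open>Without edges and arcs the set above is empty and the integrated Laplacian matrix is zero;
  the maximum is then read as \<open>0\<close>.\<close>

definition max_or_zero :: "nat set \<Rightarrow> nat" where
  "max_or_zero S = (if S = {} then 0 else Max S)"

end

theory Submission imports Defs begin

text \<open>The integrated Laplacian is the Laplacian \<open>D - W\<close> of a nonnegative weight matrix \<open>W\<close> on
  \<open>2n\<close> indices, so the Anderson--Morley argument applies. If \<open>L x = \<lambda> x\<close> then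
  \<open>\<lambda> (x\<^sub>i - x\<^sub>j) = (\<Sum>k. W\<^sub>i\<^sub>k (x\<^sub>i - x\<^sub>k)) - (\<Sum>k. W\<^sub>j\<^sub>k (x\<^sub>j - x\<^sub>k))\<close>. Choosing \<open>i, j\<close> with
  \<open>W\<^sub>i\<^sub>j > 0\<close> and \<open>\<bar>x\<^sub>i - x\<^sub>j\<bar>\<close> maximal gives \<open>\<lambda> \<le> D\<^sub>i + D\<^sub>j\<close>, unless that maximum is zero, in
  which case \<open>L x = 0\<close>.\<close>

section \<open>Laplacians of weight matrices\<close>

definition row_sum :: "real mat \<Rightarrow> nat \<Rightarrow> real" where
  "row_sum W i = (\<Sum>k<dim_col W. W $$ (i, k))"

text \<open>Row \<open>i\<close> carries its own weight sum on the diagonal, so \<open>x $ i\<close>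
  can be distributed over the terms of that row. Only differences of entries of \<open>x\<close>
  remain, and a diagonal entry of \<open>W\<close> cancels.\<close>

lemma weighted_laplacian_mult_vec:
  assumes W: "W \<in> carrier_mat m m" and x: "x \<in> carrier_vec m" and i: "i < m"
  shows "((mat_diag m (row_sum W) - W) *\<^sub>v x) $ i = (\<Sum>k<m. W $$ (i, k) * (x $ i - x $ k))"
proof -
  have "((mat_diag m (row_sum W) - W) *\<^sub>v x) $ i
      = (\<Sum>k<m. ((if i = k then row_sum W k else 0) - W $$ (i, k)) * x $ k)"
    using W x i by (auto simp: scalar_prod_def mat_diag_def atLeast0LessThan intro!: sum.cong)
  also have "\<dots> = (\<Sum>k<m. (if i = k then row_sum W k * x $ k else 0)) - (\<Sum>k<m. W $$ (i, k) * x $ k)"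
    unfolding sum_subtractf [symmetric] by (intro sum.cong) (auto simp: algebra_simps)
  also have "\<dots> = row_sum W i * x $ i - (\<Sum>k<m. W $$ (i, k) * x $ k)"
    using i by simp
  also have "\<dots> = (\<Sum>k<m. W $$ (i, k) * (x $ i - x $ k))"
    using W by (simp add: row_sum_def sum_distrib_left sum_distrib_right sum_subtractf algebra_simps)
  finally show ?thesis .
qed

lemma weighted_laplacian_eigenvalue_bound:
  assumes W: "W \<in> carrier_mat m m"
    and nonneg: "\<And>i j. i < m \<Longrightarrow> j < m \<Longrightarrow> 0 \<le> W $$ (i, j)"
    and ev: "eigenvalue (mat_diag m (row_sum W) - W) c" and "c > 0"
  obtains i j where "i < m" "j < m" "0 < W $$ (i, j)" "c \<le> row_sum W i + row_sum W j"
proof -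
  from ev W obtain x where x: "x \<in> carrier_vec m" and x0: "x \<noteq> 0\<^sub>v m"
    and eig: "(mat_diag m (row_sum W) - W) *\<^sub>v x = c \<cdot>\<^sub>v x"
    by (auto simp: eigenvalue_def eigenvector_def)
  have eqn: "c * x $ i = (\<Sum>k<m. W $$ (i, k) * (x $ i - x $ k))" if "i < m" for i
    using weighted_laplacian_mult_vec [OF W x that] eig x that by simp
  obtain p where p: "p < m" "x $ p \<noteq> 0"
    using x x0 by (metis carrier_vecD eq_vecI index_zero_vec)
  \<comment> \<open>Here \<open>c > 0\<close> enters: an eigenvector constant across all pairs of
    nonzero weight would be in the kernel. So \<open>x\<close> varies across some such pair
    \<open>(p, q)\<close>.\<close>
  then have "(\<Sum>k<m. W $$ (p, k) * (x $ p - x $ k)) \<noteq> 0"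
    using \<open>c > 0\<close> by (simp flip: eqn)
  then obtain q where q: "q < m" "W $$ (p, q) \<noteq> 0" "x $ p \<noteq> x $ q"
    by (metis (no_types, lifting) lessThan_iff mult_eq_0_iff right_minus_eq sum.neutral)
  define E where "E = {(i, j). i < m \<and> j < m \<and> 0 < W $$ (i, j)}"
  define g where "g = (\<lambda>(i, j). \<bar>x $ i - x $ j\<bar>)"
  have finE: "finite E"
    by (rule finite_subset [of _ "{..<m} \<times> {..<m}"]) (auto simp: E_def)
  have pqE: "(p, q) \<in> E"
    using p q nonneg [of p q] by (auto simp: E_def)
  \<comment> \<open>Maximising only over pairs of positive weight makes the resulting pair an actual
    adjacency. The maximum is attained because \<open>E\<close> is finite and contains
    \<open>(p, q)\<close>.\<close>
  have "Max (g ` E) \<in> g ` E"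
    using finE pqE by (intro Max_in) auto
  then obtain i j where ijE: "(i, j) \<in> E" and gij: "g (i, j) = Max (g ` E)"
    by fastforce
  define M where "M = \<bar>x $ i - x $ j\<bar>"
  have le_M: "\<bar>x $ k - x $ l\<bar> \<le> M" if "(k, l) \<in> E" for k l
  proof -
    have "g (k, l) \<le> g (i, j)"
      unfolding gij using finE that by (intro Max_ge) auto
    then show ?thesis by (simp add: M_def g_def)
  qed
  have "M > 0"
    using le_M [OF pqE] q(3) by linarith
  have ij: "i < m" "j < m" "0 < W $$ (i, j)"
    using ijE by (auto simp: E_def)
  have row_le: "\<bar>c * x $ k\<bar> \<le> row_sum W k * M" if k: "k < m" for k
  proof -
    have "\<bar>c * x $ k\<bar> \<le> (\<Sum>l<m. \<bar>W $$ (k, l) * (x $ k - x $ l)\<bar>)"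
      unfolding eqn [OF k] by (rule sum_abs)
    also have "\<dots> \<le> (\<Sum>l<m. W $$ (k, l) * M)"
    proof (rule sum_mono)
      \<comment> \<open>A pair of weight zero need not satisfy \<open>le_M\<close>, but then both
        sides vanish.\<close>
      fix l assume "l \<in> {..<m}"
      then show "\<bar>W $$ (k, l) * (x $ k - x $ l)\<bar> \<le> W $$ (k, l) * M"
        using nonneg [of k l] k le_M [of k l]
        by (cases "W $$ (k, l) = 0") (auto simp: abs_mult E_def intro!: mult_left_mono)
    qed
    finally show ?thesis
      using W by (simp add: row_sum_def sum_distrib_right)
  qed
  \<comment> \<open>The triangle inequality combines the estimates of rows \<open>i\<close> and
    \<open>j\<close>; the factor \<open>M > 0\<close> is then cancelled.\<close>
  have "c * M = \<bar>c * x $ i - c * x $ j\<bar>"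
    using \<open>c > 0\<close> by (simp add: M_def abs_mult flip: right_diff_distrib)
  also have "\<dots> \<le> (row_sum W i + row_sum W j) * M"
    using row_le [OF ij(1)] row_le [OF ij(2)] by (simp add: distrib_right)
  finally show ?thesis
    using that [OF ij] \<open>M > 0\<close> by simp
qed

text \<open>All differences of entries of the all-ones vector vanish, so it spans part of the
  kernel. This supplies an element of the spectrum.\<close>

lemma weighted_laplacian_eigenvalue_0:
  assumes W: "W \<in> carrier_mat m m" and "0 < m"
  shows "eigenvalue (mat_diag m (row_sum W) - W) 0"
proof -
  define x :: "real vec" where "x = vec m (\<lambda>_. 1)"
  have x: "x \<in> carrier_vec m" by (simp add: x_def)
  have "x \<noteq> 0\<^sub>v m"
    using \<open>0 < m\<close> by (metis index_vec index_zero_vec(1) x_def zero_neq_one)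
  moreover have "(mat_diag m (row_sum W) - W) *\<^sub>v x = 0 \<cdot>\<^sub>v x"
    using W x weighted_laplacian_mult_vec [OF W x] by (intro eq_vecI) (auto simp: x_def)
  ultimately show ?thesis
    using W x by (auto simp: eigenvalue_def eigenvector_def)
qed

section \<open>Degrees as sums of multiplicities\<close>

lemma size_filter_mset_eq_sum_count:
  assumes "finite A" and "inj_on f A" and "\<And>y. y \<in># M \<Longrightarrow> P y \<longleftrightarrow> y \<in> f ` A"
  shows "size (filter_mset P M) = (\<Sum>a\<in>A. count M (f a))"
proof -
  have "size (filter_mset P M) = (\<Sum>y\<in>set_mset (filter_mset P M). count M y)"
    by (simp add: size_multiset_overloaded_eq)
  also have "\<dots> = (\<Sum>y\<in>f ` A. count M y)"
    using assms by (intro sum.mono_neutral_left) (auto simp: not_in_iff)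
  also have "\<dots> = (\<Sum>a\<in>A. count M (f a))"
    using assms by (simp add: sum.reindex)
  finally show ?thesis .
qed

text \<open>An edge at \<open>v\<close> is determined by its other end, which lies in
  \<open>verts G\<close>. A loop is counted once on both sides.\<close>

lemma deg_eq_sum_count:
  assumes "mixed_graph G" and "v \<in> verts G"
  shows "deg G v = (\<Sum>u\<in>verts G. count (edges G) (Upair v u))"
  unfolding deg_def
proof (rule size_filter_mset_eq_sum_count)
  show "finite (verts G)" using assms by (simp add: mixed_graph_def)
  show "inj_on (Upair v) (verts G)" by (auto simp: inj_on_def)
  fix e assume "e \<in># edges G"
  then have "set_uprod e \<subseteq> verts G" using assms by (auto simp: mixed_graph_def)
  then show "v \<in> set_uprod e \<longleftrightarrow> e \<in> Upair v ` verts G"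
    by (cases e) (auto simp: image_iff)
qed

lemma out_deg_eq_sum_count:
  assumes "mixed_graph G"
  shows "out_deg G v = (\<Sum>u\<in>verts G. count (arcs G) (v, u))"
  unfolding out_deg_def using assms
  by (intro size_filter_mset_eq_sum_count) (auto simp: mixed_graph_def inj_on_def)

lemma in_deg_eq_sum_count:
  assumes "mixed_graph G"
  shows "in_deg G v = (\<Sum>u\<in>verts G. count (arcs G) (u, v))"
  unfolding in_deg_def using assms
  by (intro size_filter_mset_eq_sum_count) (auto simp: mixed_graph_def inj_on_def)

section \<open>The integrated Laplacian as a weighted Laplacian\<close>

lemma integrated_adjacency_carrier:
  "integrated_adjacency G vs \<in> carrier_mat (2 * length vs) (2 * length vs)"
  by (auto simp: integrated_adjacency_def edge_mat_def arc_mat_def)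

lemma integrated_adjacency_index:
  assumes "i < 2 * length vs" and "j < 2 * length vs"
  shows "integrated_adjacency G vs $$ (i, j) =
    (let n = length vs in
     if i < n then
       if j < n then real (count (edges G) (Upair (vs ! i) (vs ! j)))
       else real (count (arcs G) (vs ! i, vs ! (j - n)))
     else
       if j < n then real (count (arcs G) (vs ! j, vs ! (i - n)))
       else real (count (edges G) (Upair (vs ! (i - n)) (vs ! (j - n)))))"
  using assms by (auto simp: integrated_adjacency_def edge_mat_def arc_mat_def Let_def)

lemma sum_lessThan_add:
  fixes f :: "nat \<Rightarrow> 'b::comm_monoid_add"
  shows "(\<Sum>k<m + n. f k) = (\<Sum>k<m. f k) + (\<Sum>k<n. f (m + k))"
  by (induction n) (simp_all add: add.assoc)

text \<open>The row of a first copy lists the edges at the vertex and the arcs leaving it. The row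
  of a second copy meets the transposed arc block, hence lists the arcs entering it.\<close>

lemma row_sum_integrated_adjacency:
  assumes G: "mixed_graph G" and vs: "distinct vs" "set vs = verts G"
    and i: "i < 2 * length vs"
  shows "row_sum (integrated_adjacency G vs) i =
    (let n = length vs in
     if i < n then real (deg G (vs ! i) + out_deg G (vs ! i))
     else real (deg G (vs ! (i - n)) + in_deg G (vs ! (i - n))))"
proof -
  define n where "n = length vs"
  have reindex: "(\<Sum>k<n. f (vs ! k)) = (\<Sum>u\<in>verts G. f u)" for f :: "'a \<Rightarrow> real"
    using sum.reindex_bij_betw [OF bij_betw_nth [OF vs(1) refl vs(2)[symmetric]], of f]
    by (simp add: n_def)
  have mem: "vs ! k \<in> verts G" if "k < n" for k
    using that vs by (auto simp: n_def)
  \<comment> \<open>The columns split into first copies \<open>k\<close> and second copies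
    \<open>n + k\<close>.\<close>
  have "row_sum (integrated_adjacency G vs) i
      = (\<Sum>k<n. integrated_adjacency G vs $$ (i, k))
        + (\<Sum>k<n. integrated_adjacency G vs $$ (i, n + k))"
    using integrated_adjacency_carrier [of G vs]
    by (simp add: row_sum_def mult_2 sum_lessThan_add n_def)
  also have "\<dots> = (if i < n
      then (\<Sum>k<n. real (count (edges G) (Upair (vs ! i) (vs ! k))))
         + (\<Sum>k<n. real (count (arcs G) (vs ! i, vs ! k)))
      else (\<Sum>k<n. real (count (arcs G) (vs ! k, vs ! (i - n))))
         + (\<Sum>k<n. real (count (edges G) (Upair (vs ! (i - n)) (vs ! k)))))"
    using i by (auto simp: integrated_adjacency_index Let_def n_def)
  also have "\<dots> = (if i < n then real (deg G (vs ! i) + out_deg G (vs ! i))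
     else real (deg G (vs ! (i - n)) + in_deg G (vs ! (i - n))))"
    using i mem [of i] mem [of "i - n"]
    unfolding reindex [of "\<lambda>u. real (count (edges G) (Upair (vs ! k) u))" for k]
      reindex [of "\<lambda>u. real (count (arcs G) (vs ! k, u))" for k]
      reindex [of "\<lambda>u. real (count (arcs G) (u, vs ! k))" for k]
    by (auto simp: deg_eq_sum_count [OF G] out_deg_eq_sum_count [OF G]
        in_deg_eq_sum_count [OF G] n_def)
  finally show ?thesis by (simp add: Let_def n_def)
qed

lemma integrated_laplacian_eq:
  assumes "mixed_graph G" and "distinct vs" and "set vs = verts G"
  shows "integrated_laplacian G vs =
    mat_diag (2 * length vs) (row_sum (integrated_adjacency G vs)) - integrated_adjacency G vs"
proof -
  have "integrated_degree G vs = mat_diag (2 * length vs) (row_sum (integrated_adjacency G vs))"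
    by (rule eq_matI)
      (auto simp: integrated_degree_def Let_def mat_diag_def row_sum_integrated_adjacency [OF assms])
  then show ?thesis by (simp add: integrated_laplacian_def)
qed

section \<open>From matrix entries to the bound set\<close>

lemma finite_bound_set:
  assumes "finite (verts G)"
  shows "finite (bound_set G)"
proof -
  have "bound_set G \<subseteq> (\<Union>u\<in>verts G. \<Union>v\<in>verts G.
      {deg G u + deg G v + out_deg G u + out_deg G v,
       deg G u + deg G v + in_deg G u + in_deg G v,
       deg G u + deg G v + out_deg G u + in_deg G v})"
    by (auto simp: bound_set_def)
  then show ?thesis
    by (rule finite_subset) (use assms in auto)
qed

text \<open>The block containing \<open>(i, j)\<close> decides the kind of adjacency: the diagonal
  blocks give edges, with out-degrees for first copies and in-degrees for second copies, and the
  off-diagonal blocks give arcs.\<close>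

lemma row_sum_add_in_bound_set:
  assumes G: "mixed_graph G" and vs: "distinct vs" "set vs = verts G"
    and ij: "i < 2 * length vs" "j < 2 * length vs"
    and pos: "0 < integrated_adjacency G vs $$ (i, j)"
  obtains b where "b \<in> bound_set G"
    and "row_sum (integrated_adjacency G vs) i + row_sum (integrated_adjacency G vs) j = real b"
proof -
  let ?n = "length vs"
  note W = pos [unfolded integrated_adjacency_index [OF ij] Let_def]
  note r = row_sum_integrated_adjacency [OF G vs ij(1)] row_sum_integrated_adjacency [OF G vs ij(2)]
  have mem: "vs ! k \<in> verts G" if "k < ?n" for k
    using that vs by auto
  have memi: "vs ! (i - ?n) \<in> verts G" if "\<not> i < ?n" using that ij by (intro mem) auto
  have memj: "vs ! (j - ?n) \<in> verts G" if "\<not> j < ?n" using that ij by (intro mem) auto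
  consider "i < ?n" "j < ?n" | "i < ?n" "\<not> j < ?n" | "\<not> i < ?n" "j < ?n" | "\<not> i < ?n" "\<not> j < ?n"
    by blast
  then show thesis
  proof cases
    case 1
    let ?u = "vs ! i" and ?v = "vs ! j"
    have "deg G ?u + deg G ?v + out_deg G ?u + out_deg G ?v \<in> bound_set G"
      using 1 W mem by (auto simp: bound_set_def)
    from that [OF this] show thesis using 1 r by (simp add: Let_def)
  next
    case 2
    let ?u = "vs ! i" and ?v = "vs ! (j - ?n)"
    have "deg G ?u + deg G ?v + out_deg G ?u + in_deg G ?v \<in> bound_set G"
      using 2 W mem memj by (auto simp: bound_set_def)
    from that [OF this] show thesis using 2 r by (simp add: Let_def)
  next
    case 3
    \<comment> \<open>The lower left block is transposed, so the arc starts at the vertex of the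
      column.\<close>
    let ?u = "vs ! j" and ?v = "vs ! (i - ?n)"
    have "deg G ?u + deg G ?v + out_deg G ?u + in_deg G ?v \<in> bound_set G"
      using 3 W mem memi by (auto simp: bound_set_def)
    from that [OF this] show thesis using 3 r by (simp add: Let_def)
  next
    case 4
    let ?u = "vs ! (i - ?n)" and ?v = "vs ! (j - ?n)"
    have "deg G ?u + deg G ?v + in_deg G ?u + in_deg G ?v \<in> bound_set G"
      using 4 W memi memj by (auto simp: bound_set_def)
    from that [OF this] show thesis using 4 r by (simp add: Let_def)
  qed
qed

theorem theorem3p17:
  fixes G :: "'a mixed_graph" and vs :: "'a list"
  assumes "simple_mixed_graph G"
    and "verts G \<noteq> {}"
    and "distinct vs" and "set vs = verts G"
  shows "nu1 G vs \<le> real (max_or_zero (bound_set G))"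
proof -
  let ?W = "integrated_adjacency G vs" and ?m = "2 * length vs"
  have G: "mixed_graph G" using assms(1) by (simp add: simple_mixed_graph_def)
  note W = integrated_adjacency_carrier [of G vs]
  note L = integrated_laplacian_eq [OF G assms(3,4)]
  have carrier: "integrated_laplacian G vs \<in> carrier_mat ?m ?m"
    unfolding L using W by auto
  have "0 < ?m" using assms(2,4) by auto
  then have "0 \<in> spectrum (integrated_laplacian G vs)"
    unfolding L spectrum_def using weighted_laplacian_eigenvalue_0 [OF W] by simp
  \<comment> \<open>Nonemptiness matters: \<open>Max\<close> of an empty real spectrum would be unspecified.\<close>
  then have "nu1 G vs \<in> spectrum (integrated_laplacian G vs)"
    unfolding nu1_def using card_finite_spectrum(1) [OF carrier] by (intro Max_in) auto
  then have ev: "eigenvalue (mat_diag ?m (row_sum ?W) - ?W) (nu1 G vs)"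
    by (simp add: spectrum_def L)
  \<comment> \<open>If \<open>nu1 G vs\<close> is not positive, the bound holds because its right
    side is a natural number; this covers an empty \<open>bound_set G\<close>.\<close>
  show ?thesis
  proof (cases "nu1 G vs > 0")
    case True
    have "0 \<le> ?W $$ (i, j)" if "i < ?m" "j < ?m" for i j
      using that by (simp add: integrated_adjacency_index Let_def)
    from weighted_laplacian_eigenvalue_bound [OF W this ev True]
    obtain i j where ij: "i < ?m" "j < ?m" "0 < ?W $$ (i, j)"
      and le: "nu1 G vs \<le> row_sum ?W i + row_sum ?W j" by blast
    obtain b where b: "b \<in> bound_set G" "row_sum ?W i + row_sum ?W j = real b"
      using row_sum_add_in_bound_set [OF G assms(3,4) ij] .
    have "b \<le> Max (bound_set G)"
      using b(1) G by (intro Max_ge finite_bound_set) (auto simp: mixed_graph_def)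
    \<comment> \<open>The witness \<open>b\<close> shows that \<open>bound_set G\<close> is
      nonempty, so \<open>max_or_zero\<close> is the true maximum here.\<close>
    then show ?thesis
      using le b by (auto simp: max_or_zero_def)
  qed simp
qed

end
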